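(* Let $(\mathfrak g,\varphi_i,\xi_i,\eta_i)$ be an almost $3$-contact Lie algebra with abelian structure. Then $\mathcal Z$ is a central element of $\mathfrak g$ if and only if the endomorphism $\psi$ of $\mathfrak h$ satisfies $\psi^2+\delta\psi=0$.
   Context: An almost contact structure on a real Lie algebra $\mathfrak g$ is a triple $(\varphi,\xi,\eta)$, $\varphi\in\mathrm{End}(\mathfrak g)$, $\xi\in\mathfrak g$, $\eta\in\mathfrak g^*$, with $\varphi^2=-I+\eta\otimes\xi$ and $\eta(\xi)=1$. It is abelian if $\mathrm{ad}_\xi\circ\varphi=\varphi\circ\mathrm{ad}_\xi$ and $[\varphi X,\varphi Y]=[X,Y]$ for all $X,Y\in\operatorname{Ker}\eta$. An almost $3$-contact Lie algebra is a real Lie algebra $\mathfrak g$ of dimension $4n+3$ with three almost contact structures $(\varphi_i,\xi_i,\eta_i)$, $i=1,2,3$, such that for every even permutation $(i,j,k)$ of $(1,2,3)$: $\varphi_k=\varphi_i\varphi_j-\eta_j\otimes\xi_i=-\varphi_j\varphi_i+\eta_i\otimes\xi_j$, $\xi_k=\varphi_i\xi_j=-\varphi_j\xi_i$, $\eta_k=\eta_i\circ\varphi_j=-\eta_j\circ\varphi_i$. It is abelian if each $(\varphi_i,\xi_i,\eta_i)$ is abelian. Set $\mathfrak h=\bigcap_i\operatorname{Ker}\eta_i$. For an abelian structure the following are well defined: $\mathcal Z:=\varphi_i([\xi_j,\xi_k])\in\mathfrak h$ and $\delta\in\mathbb R$ with $2\delta=\eta_i([\xi_j,\xi_k])$ (independent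 of the even permutation $(i,j,k)$ of $(1,2,3)$); and $\psi:=(\mathrm{ad}_{\xi_i}\circ\varphi_i)|_{\mathfrak h}=(\varphi_i\circ\mathrm{ad}_{\xi_i})|_{\mathfrak h}:\mathfrak h\to\mathfrak h$ (independent of $i$). *)

theory Defs
  imports "HOL-Analysis.Analysis"
begin

text \<open>The Lie algebra is carried by a whole type of class \<open>real_vector\<close>.\<close>

locale real_lie_algebra =
  fixes br :: "'a::real_vector \<Rightarrow> 'a \<Rightarrow> 'a"
  assumes bilinear_br: "bilinear br"
    and br_self: "br x x = 0"
    and jacobi: "br x (br y z) + br y (br z x) + br z (br x y) = 0"

definition lie_center :: "('a::real_vector \<Rightarrow> 'a \<Rightarrow> 'a) \<Rightarrow> 'a set" where
  "lie_center br = {z. \<forall>x. br z x = 0}"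

locale almost_contact =
  fixes \<phi> :: "'a::real_vector \<Rightarrow> 'a" and \<xi> :: 'a and \<eta> :: "'a \<Rightarrow> real"
  assumes linear_phi: "linear \<phi>"
    and linear_eta: "linear \<eta>"
    and phi_phi: "\<phi> (\<phi> x) = - x + \<eta> x *\<^sub>R \<xi>"
    and eta_xi: "\<eta> \<xi> = 1"

locale abelian_almost_contact = real_lie_algebra br + almost_contact \<phi> \<xi> \<eta>
  for br :: "'a::real_vector \<Rightarrow> 'a \<Rightarrow> 'a" and \<phi> \<xi> \<eta> +
  assumes ad_xi_phi: "br \<xi> (\<phi> x) = \<phi> (br \<xi> x)"
    and br_phi_phi: "\<eta> x = 0 \<Longrightarrow> \<eta> y = 0 \<Longrightarrow> br (\<phi> x) (\<phi> y) = br x y"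

text \<open>The three structures are families indexed by \<open>nat\<close>, of which only the members
  with index in \<open>{1, 2, 3}\<close> are constrained.\<close>

definition even_perms3 :: "(nat \<times> nat \<times> nat) set" where
  "even_perms3 = {(1, 2, 3), (2, 3, 1), (3, 1, 2)}"

text \<open>A vector space that is not finite-dimensional has \<open>dim UNIV = 0\<close>, so the
  dimension condition below entails finite-dimensionality.\<close>

locale almost_3_contact_lie_algebra = real_lie_algebra br
  for br :: "'a::real_vector \<Rightarrow> 'a \<Rightarrow> 'a" +
  fixes \<phi> :: "nat \<Rightarrow> 'a \<Rightarrow> 'a" and \<xi> :: "nat \<Rightarrow> 'a" and \<eta> :: "nat \<Rightarrow> 'a \<Rightarrow> real"
  assumes dim_4n3: "\<exists>n. dim (UNIV :: 'a set) = 4 * n + 3"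
    and almost_contact: "i \<in> {1, 2, 3} \<Longrightarrow> almost_contact (\<phi> i) (\<xi> i) (\<eta> i)"
    and phi_k: "(i, j, k) \<in> even_perms3 \<Longrightarrow> \<phi> k x = \<phi> i (\<phi> j x) - \<eta> j x *\<^sub>R \<xi> i"
    and phi_k': "(i, j, k) \<in> even_perms3 \<Longrightarrow> \<phi> k x = - \<phi> j (\<phi> i x) + \<eta> i x *\<^sub>R \<xi> j"
    and xi_k: "(i, j, k) \<in> even_perms3 \<Longrightarrow> \<xi> k = \<phi> i (\<xi> j)"
    and xi_k': "(i, j, k) \<in> even_perms3 \<Longrightarrow> \<xi> k = - \<phi> j (\<xi> i)"
    and eta_k: "(i, j, k) \<in> even_perms3 \<Longrightarrow> \<eta> k x = \<eta> i (\<phi> j x)"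
    and eta_k': "(i, j, k) \<in> even_perms3 \<Longrightarrow> \<eta> k x = - \<eta> j (\<phi> i x)"

locale abelian_almost_3_contact_lie_algebra = almost_3_contact_lie_algebra br \<phi> \<xi> \<eta>
  for br :: "'a::real_vector \<Rightarrow> 'a \<Rightarrow> 'a" and \<phi> \<xi> \<eta> +
  assumes abelian: "i \<in> {1, 2, 3} \<Longrightarrow> abelian_almost_contact br (\<phi> i) (\<xi> i) (\<eta> i)"

definition horizontal :: "(nat \<Rightarrow> 'a::real_vector \<Rightarrow> real) \<Rightarrow> 'a set" where
  "horizontal \<eta> = (\<Inter>i\<in>{1, 2, 3}. {x. \<eta> i x = 0})"

text \<open>For abelian structures the choices of indices made in the following three definitions
  are immaterial, and \<open>psi\<close> maps \<open>horizontal \<eta>\<close> into itself; see the lemmas below.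
  Outside \<open>horizontal \<eta>\<close> the values of \<open>psi\<close> carry no meaning.\<close>

definition Zvec :: "('a::real_vector \<Rightarrow> 'a \<Rightarrow> 'a) \<Rightarrow> (nat \<Rightarrow> 'a \<Rightarrow> 'a) \<Rightarrow> (nat \<Rightarrow> 'a) \<Rightarrow> 'a" where
  "Zvec br \<phi> \<xi> = \<phi> 1 (br (\<xi> 2) (\<xi> 3))"

definition delta :: "('a::real_vector \<Rightarrow> 'a \<Rightarrow> 'a) \<Rightarrow> (nat \<Rightarrow> 'a) \<Rightarrow> (nat \<Rightarrow> 'a \<Rightarrow> real) \<Rightarrow> real" where
  "delta br \<xi> \<eta> = \<eta> 1 (br (\<xi> 2) (\<xi> 3)) / 2"

definition psi :: "('a::real_vector \<Rightarrow> 'a \<Rightarrow> 'a) \<Rightarrow> (nat \<Rightarrow> 'a \<Rightarrow> 'a) \<Rightarrow> (nat \<Rightarrow> 'a) \<Rightarrow> 'a \<Rightarrow> 'a" where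
  "psi br \<phi> \<xi> x = br (\<xi> 1) (\<phi> 1 x)"

context almost_contact
begin

lemma phi_xi: "\<phi> \<xi> = 0"
proof -
  interpret \<phi>: linear \<phi> by (rule linear_phi)
  define c where "c = \<eta> (\<phi> \<xi>)"
  have 0: "\<phi> (\<phi> \<xi>) = 0" by (simp only: phi_phi eta_xi) simp
  have "\<phi> (\<phi> (\<phi> \<xi>)) = 0" by (simp only: 0 \<phi>.zero)
  then have 1: "\<phi> \<xi> = c *\<^sub>R \<xi>" using phi_phi[of "\<phi> \<xi>"] by (simp add: c_def)
  have "\<phi> (\<phi> \<xi>) = c *\<^sub>R \<phi> \<xi>" by (simp only: 1 \<phi>.scale)
  with 0 have "c = 0 \<or> \<phi> \<xi> = 0" by simp
  with 1 show ?thesis by auto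
qed

lemma eta_phi: "\<eta> (\<phi> x) = 0"
proof -
  interpret \<phi>: linear \<phi> by (rule linear_phi)
  have "\<phi> (\<phi> (\<phi> x)) = \<phi> (- x + \<eta> x *\<^sub>R \<xi>)"
    by (simp only: phi_phi)
  also have "\<dots> = - \<phi> x"
    by (simp only: \<phi>.add \<phi>.neg \<phi>.scale phi_xi) simp
  finally have "\<eta> (\<phi> x) *\<^sub>R \<xi> = 0" using phi_phi[of "\<phi> x"] by simp
  moreover have "\<xi> \<noteq> 0"
    using eta_xi linear_0[OF linear_eta] by auto
  ultimately show ?thesis by simp
qed

end

context abelian_almost_3_contact_lie_algebra
begin

lemma br_neg: "br x (- y) = - br x y" "br (- x) y = - br x y"
  using bilinear_rneg[OF bilinear_br] bilinear_lneg[OF bilinear_br] by auto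

lemma br_swap: "br x y = - br y x"
proof -
  have "0 = br (x + y) (x + y)" by (rule br_self[symmetric])
  also have "\<dots> = br x y + br y x"
    by (simp only: bilinear_ladd[OF bilinear_br] bilinear_radd[OF bilinear_br]
        br_self[of x] br_self[of y]) simp
  finally have "br x y + br y x = 0" by simp
  then show ?thesis by (simp add: eq_neg_iff_add_eq_0)
qed

lemma even_perms3_cycle: "(i, j, k) \<in> even_perms3 \<Longrightarrow> (j, k, i) \<in> even_perms3"
  by (auto simp: even_perms3_def)

lemma even_perms3_mem: "(i, j, k) \<in> even_perms3 \<Longrightarrow> i \<in> {1,2,3} \<and> j \<in> {1,2,3} \<and> k \<in> {1,2,3}"
  by (auto simp: even_perms3_def)

lemma step:
  assumes p: "(i, j, k) \<in> even_perms3"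
  shows Z_step: "\<phi> k (br (\<xi> i) (\<xi> j)) = \<phi> i (br (\<xi> j) (\<xi> k))"
    and delta_step: "\<eta> k (br (\<xi> i) (\<xi> j)) = \<eta> i (br (\<xi> j) (\<xi> k))"
proof -
  note p2 = even_perms3_cycle[OF p]
  interpret B: abelian_almost_contact br "\<phi> j" "\<xi> j" "\<eta> j"
    using abelian even_perms3_mem[OF p] by blast
  have "\<phi> j (br (\<xi> i) (\<xi> j)) = \<phi> j (- br (\<xi> j) (\<xi> i))"
    by (simp only: br_swap[of "\<xi> i" "\<xi> j"])
  also have "\<dots> = - br (\<xi> j) (\<phi> j (\<xi> i))"
    by (simp only: linear_neg[OF B.linear_phi] B.ad_xi_phi)
  also have "\<phi> j (\<xi> i) = - \<xi> k" using xi_k'[OF p] by simp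
  finally have c: "\<phi> j (br (\<xi> i) (\<xi> j)) = br (\<xi> j) (\<xi> k)"
    by (simp add: br_neg)
  have "br (\<xi> j) (\<xi> i) = \<phi> j (br (\<xi> j) (\<xi> k))"
    by (simp only: B.ad_xi_phi[symmetric] xi_k[OF p2])
  then have "br (\<xi> i) (\<xi> j) = - \<phi> j (br (\<xi> j) (\<xi> k))"
    using br_swap[of "\<xi> i" "\<xi> j"] by simp
  then have e: "\<eta> j (br (\<xi> i) (\<xi> j)) = 0"
    by (simp only: linear_neg[OF B.linear_eta] B.eta_phi minus_zero)
  show "\<phi> k (br (\<xi> i) (\<xi> j)) = \<phi> i (br (\<xi> j) (\<xi> k))"
    using phi_k[OF p, of "br (\<xi> i) (\<xi> j)"] by (simp only: c e) simp
  show "\<eta> k (br (\<xi> i) (\<xi> j)) = \<eta> i (br (\<xi> j) (\<xi> k))"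
    using eta_k[OF p, of "br (\<xi> i) (\<xi> j)"] by (simp only: c)
qed

lemma Zvec_eq:
  assumes "(i, j, k) \<in> even_perms3" shows "Zvec br \<phi> \<xi> = \<phi> i (br (\<xi> j) (\<xi> k))"
proof -
  have p: "(1, 2, 3) \<in> even_perms3" "(3, 1, 2) \<in> even_perms3" by (auto simp: even_perms3_def)
  from assms consider "i = 1" "j = 2" "k = 3" | "i = 2" "j = 3" "k = 1" | "i = 3" "j = 1" "k = 2"
    by (auto simp: even_perms3_def)
  then show ?thesis
    by cases (simp_all only: Zvec_def Z_step[OF p(1)] Z_step[OF p(2)])
qed

lemma delta_eq:
  assumes "(i, j, k) \<in> even_perms3" shows "2 * delta br \<xi> \<eta> = \<eta> i (br (\<xi> j) (\<xi> k))"
proof -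
  have p: "(1, 2, 3) \<in> even_perms3" "(3, 1, 2) \<in> even_perms3" by (auto simp: even_perms3_def)
  have d: "2 * delta br \<xi> \<eta> = \<eta> 1 (br (\<xi> 2) (\<xi> 3))" by (simp add: delta_def)
  from assms consider "i = 1" "j = 2" "k = 3" | "i = 2" "j = 3" "k = 1" | "i = 3" "j = 1" "k = 2"
    by (auto simp: even_perms3_def)
  then show ?thesis
    by cases (simp_all only: d delta_step[OF p(1)] delta_step[OF p(2)])
qed

lemma Zvec_horizontal: "Zvec br \<phi> \<xi> \<in> horizontal \<eta>"
proof -
  have "\<eta> i (Zvec br \<phi> \<xi>) = 0" if "(i, j, k) \<in> even_perms3" for i j k
    using even_perms3_mem[OF that] by (simp only: Zvec_eq[OF that] almost_contact.eta_phi[OF almost_contact])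
  from this[of 1 2 3] this[of 2 3 1] this[of 3 1 2] show ?thesis
    by (simp add: horizontal_def even_perms3_def)
qed

lemma psi_eq:
  assumes x: "x \<in> horizontal \<eta>" and i: "i \<in> {1, 2, 3}"
  shows "psi br \<phi> \<xi> x = br (\<xi> i) (\<phi> i x)" and "psi br \<phi> \<xi> x = \<phi> i (br (\<xi> i) x)"
proof -
  have z: "\<eta> l x = 0" if "l \<in> {1, 2, 3}" for l using x that by (auto simp: horizontal_def)
  have st: "br (\<xi> a) (\<phi> a x) = br (\<xi> b) (\<phi> b x)" if p: "(a, b, c) \<in> even_perms3" for a b c
  proof -
    note p2 = even_perms3_cycle[OF p]
    note p3 = even_perms3_cycle[OF p2]
    note m = even_perms3_mem[OF p]
    interpret C: abelian_almost_contact br "\<phi> c" "\<xi> c" "\<eta> c"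
      using abelian m by blast
    have "\<eta> c (\<xi> a) = - \<eta> c (\<phi> c (\<xi> b))"
      using xi_k'[OF p2] by (simp add: linear_neg[OF C.linear_eta])
    then have "\<eta> c (\<xi> a) = 0" by (simp add: C.eta_phi)
    moreover have "\<eta> c (\<phi> a x) = 0" using eta_k[OF p3, of x] z[of b] m by simp
    ultimately have "br (\<phi> c (\<xi> a)) (\<phi> c (\<phi> a x)) = br (\<xi> a) (\<phi> a x)" by (rule C.br_phi_phi)
    moreover have "\<phi> c (\<xi> a) = \<xi> b" using xi_k[OF p3] by simp
    moreover have "\<phi> c (\<phi> a x) = \<phi> b x" using phi_k[OF p3, of x] z[of a] m by simp
    ultimately show ?thesis by simp
  qed
  show 1: "psi br \<phi> \<xi> x = br (\<xi> i) (\<phi> i x)"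
  proof -
    have p: "(1, 2, 3) \<in> even_perms3" "(2, 3, 1) \<in> even_perms3" by (auto simp: even_perms3_def)
    from i consider "i = 1" | "i = 2" | "i = 3" by auto
    then show ?thesis
      by cases (simp_all only: psi_def st[OF p(1)] st[OF p(2)])
  qed
  show "psi br \<phi> \<xi> x = \<phi> i (br (\<xi> i) x)"
    by (simp only: 1 abelian_almost_contact.ad_xi_phi[OF abelian[OF i]])
qed

lemma psi_horizontal:
  assumes "x \<in> horizontal \<eta>" shows "psi br \<phi> \<xi> x \<in> horizontal \<eta>"
proof -
  have "\<eta> i (psi br \<phi> \<xi> x) = 0" if i: "i \<in> {1, 2, 3}" for i
    by (simp only: psi_eq(2)[OF assms i] almost_contact.eta_phi[OF almost_contact[OF i]])
  then show ?thesis by (auto simp: horizontal_def)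
qed

end

end

theory Submission
  imports Defs
begin

text \<open>On the horizontal subspace \<open>ad \<xi>\<^sub>i = - \<phi>\<^sub>i \<psi>\<close>, while \<open>[\<xi>\<^sub>j, \<xi>\<^sub>k] = 2\<delta> \<xi>\<^sub>i - \<phi>\<^sub>i Z\<close>. The Jacobi
  identity for \<open>\<xi>\<^sub>j, \<xi>\<^sub>k\<close> and a horizontal \<open>x\<close> therefore reads
  \<open>[\<phi>\<^sub>i Z, x] = - 2 \<phi>\<^sub>i (\<psi>\<^sup>2 + \<delta>\<psi>) x\<close>, and applying it to \<open>\<phi>\<^sub>i x\<close> gives
  \<open>[Z, x] = 2 (\<psi>\<^sup>2 + \<delta>\<psi>) x\<close>. The Jacobi identity for \<open>\<xi>\<^sub>1, \<xi>\<^sub>2, \<xi>\<^sub>3\<close> gives \<open>3 \<psi> Z = 0\<close>, so \<open>Z\<close>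
  always commutes with the \<open>\<xi>\<^sub>i\<close>.\<close>

context abelian_almost_3_contact_lie_algebra
begin

abbreviation (input) "H \<equiv> horizontal \<eta>"
abbreviation (input) "\<psi> \<equiv> psi br \<phi> \<xi>"
abbreviation (input) "\<delta> \<equiv> delta br \<xi> \<eta>"
abbreviation (input) "Z \<equiv> Zvec br \<phi> \<xi>"

lemma eta_horizontal: "x \<in> H \<Longrightarrow> i \<in> {1, 2, 3} \<Longrightarrow> \<eta> i x = 0"
  by (auto simp: horizontal_def)

text \<open>Lets facts about a single index use the structure relations, which are stated for even
  permutations only.\<close>

lemma even_perms3_extend:
  assumes "i \<in> {1, 2, 3}"
  obtains j k where "(i, j, k) \<in> even_perms3" "{1, 2, 3} = {i, j, k}"
proof -
  from assms consider "i = 1" | "i = 2" | "i = 3" by auto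
  then show thesis
  proof cases
    case 1 then show ?thesis using that[of 2 3] by (auto simp: even_perms3_def)
  next
    case 2 then show ?thesis using that[of 3 1] by (auto simp: even_perms3_def)
  next
    case 3 then show ?thesis using that[of 1 2] by (auto simp: even_perms3_def)
  qed
qed

lemma linear_phi_i: "i \<in> {1, 2, 3} \<Longrightarrow> linear (\<phi> i)"
  using almost_contact almost_contact.linear_phi by blast

lemma linear_eta_i: "i \<in> {1, 2, 3} \<Longrightarrow> linear (\<eta> i)"
  using almost_contact almost_contact.linear_eta by blast

text \<open>Besides \<open>\<eta> i \<circ> \<phi> i = 0\<close>, the relations give
  \<open>\<eta> j \<circ> \<phi> i = - \<eta> k\<close> and
  \<open>\<eta> k \<circ> \<phi> i = \<eta> j\<close>.\<close>

lemma phi_horizontal: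
  assumes x: "x \<in> H" and i: "i \<in> {1, 2, 3}"
  shows "\<phi> i x \<in> H"
proof -
  obtain j k where p: "(i, j, k) \<in> even_perms3" and s: "{1, 2, 3} = {i, j, k}"
    using even_perms3_extend[OF i] .
  have "\<eta> i (\<phi> i x) = 0"
    using almost_contact.eta_phi[OF almost_contact[OF i]] .
  moreover have "\<eta> j (\<phi> i x) = 0"
    using eta_k'[OF p, of x] eta_horizontal[OF x, of k] even_perms3_mem[OF p] by simp
  moreover have "\<eta> k (\<phi> i x) = 0"
    using eta_k[OF even_perms3_cycle[OF even_perms3_cycle[OF p]], of x] eta_horizontal[OF x, of j]
      even_perms3_mem[OF p] by simp
  ultimately show ?thesis
    unfolding horizontal_def s by simp
qed

text \<open>The other two Reeb vectors are, up to sign, images under \<open>\<phi> i\<close> of each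
  other, and \<open>\<eta> i\<close> vanishes on the range of \<open>\<phi> i\<close>.\<close>

lemma eta_xi_neq:
  assumes i: "i \<in> {1, 2, 3}" and j: "j \<in> {1, 2, 3}" and "i \<noteq> j"
  shows "\<eta> i (\<xi> j) = 0"
proof -
  obtain b c where p: "(i, b, c) \<in> even_perms3" and s: "{1, 2, 3} = {i, b, c}"
    using even_perms3_extend[OF i] .
  have e: "\<eta> i (\<phi> i x) = 0" for x
    using almost_contact.eta_phi[OF almost_contact[OF i]] .
  have "\<eta> i (\<xi> c) = 0"
    by (simp only: xi_k[OF p] e)
  moreover have "\<eta> i (\<xi> b) = 0"
    by (simp only: xi_k'[OF even_perms3_cycle[OF even_perms3_cycle[OF p]]]
        linear_neg[OF linear_eta_i[OF i]] e minus_zero)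
  moreover have "j = b \<or> j = c" using j \<open>i \<noteq> j\<close> unfolding s by auto
  ultimately show ?thesis by auto
qed

lemma phi_phi_horizontal:
  assumes "x \<in> H" "i \<in> {1, 2, 3}"
  shows "\<phi> i (\<phi> i x) = - x"
  using almost_contact.phi_phi[OF almost_contact[OF assms(2)], of x] eta_horizontal[OF assms]
  by simp

text \<open>Since \<open>psi\<close> is both \<open>ad \<xi> i \<circ> \<phi> i\<close> and
  \<open>\<phi> i \<circ> ad \<xi> i\<close> on \<open>H\<close>, both sides are
  \<open>\<phi> i [\<xi> i, \<phi> i x]\<close>.\<close>

lemma phi_psi_commute:
  assumes "x \<in> H" "i \<in> {1, 2, 3}"
  shows "\<phi> i (\<psi> x) = \<psi> (\<phi> i x)"
  by (simp only: psi_eq(1)[OF assms] psi_eq(2)[OF phi_horizontal[OF assms] assms(2)])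

lemma br_xi_horizontal:
  assumes x: "x \<in> H" and i: "i \<in> {1, 2, 3}"
  shows "br (\<xi> i) x = - \<phi> i (\<psi> x)"
  using psi_eq(1)[OF phi_horizontal[OF x i] i]
  by (simp add: phi_phi_horizontal[OF x i] phi_psi_commute[OF x i] br_neg)

lemma br_xi_xi:
  assumes p: "(i, j, k) \<in> even_perms3"
  shows "br (\<xi> j) (\<xi> k) = (2 * \<delta>) *\<^sub>R \<xi> i - \<phi> i Z"
proof -
  have i: "i \<in> {1, 2, 3}" using even_perms3_mem[OF p] by blast
  show ?thesis
    by (simp only: delta_eq[OF p] Zvec_eq[OF p] almost_contact.phi_phi[OF almost_contact[OF i]])
      simp
qed

lemma psi_Zvec: "\<psi> Z = 0"
proof -
  \<comment> \<open>In \<open>br_xi_xi\<close> the \<xi>-term dies under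
    \<open>br (\<xi> i)\<close>, and the rest is \<open>- br (\<xi> i) (\<phi> i Z)\<close>. As
    \<open>psi\<close> does not depend on the index, the three Jacobi terms coincide.\<close>
  have cyc: "br (\<xi> i) (br (\<xi> j) (\<xi> k)) = - \<psi> Z" if p: "(i, j, k) \<in> even_perms3" for i j k
  proof -
    have i: "i \<in> {1, 2, 3}" using even_perms3_mem[OF p] by blast
    show ?thesis
      by (simp add: br_xi_xi[OF p] bilinear_rsub[OF bilinear_br] bilinear_rmul[OF bilinear_br]
          br_self psi_eq(1)[OF Zvec_horizontal i])
  qed
  have p: "(1, 2, 3) \<in> even_perms3" "(2, 3, 1) \<in> even_perms3" "(3, 1, 2) \<in> even_perms3"
    by (auto simp: even_perms3_def)
  have "- \<psi> Z + - \<psi> Z + - \<psi> Z = 0"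
    using jacobi[of "\<xi> 1" "\<xi> 2" "\<xi> 3"] by (simp only: cyc[OF p(1)] cyc[OF p(2)] cyc[OF p(3)])
  then have "(-3) *\<^sub>R \<psi> Z = 0"
    by (simp add: scaleR_left.add[of "-2" "-1", simplified] scaleR_2)
  then show ?thesis by simp
qed

lemma br_Zvec_xi:
  assumes i: "i \<in> {1, 2, 3}"
  shows "br Z (\<xi> i) = 0"
  using br_xi_horizontal[OF Zvec_horizontal i] br_swap[of Z "\<xi> i"]
  by (simp add: psi_Zvec linear_0[OF linear_phi_i[OF i]])

lemma br_phi_Zvec:
  assumes p: "(i, j, k) \<in> even_perms3" and x: "x \<in> H"
  shows "br (\<phi> i Z) x = (-2) *\<^sub>R \<phi> i (\<psi> (\<psi> x) + \<delta> *\<^sub>R \<psi> x)"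
proof -
  have i: "i \<in> {1, 2, 3}" and j: "j \<in> {1, 2, 3}" and k: "k \<in> {1, 2, 3}"
    using even_perms3_mem[OF p] by auto
  note p2 = even_perms3_cycle[OF p]
  let ?w = "\<psi> (\<psi> x)"
  note h = psi_horizontal[OF x]
  note hh = psi_horizontal[OF h]
  \<comment> \<open>The two minus signs from \<open>br_xi_horizontal\<close> cancel, and the inner
    \<open>\<psi>\<close> is moved past \<open>\<phi> b\<close>.\<close>
  have ad2: "br (\<xi> a) (br (\<xi> b) x) = \<phi> a (\<phi> b ?w)"
    if a: "a \<in> {1, 2, 3}" and b: "b \<in> {1, 2, 3}" for a b
    by (simp add: br_xi_horizontal[OF x b] br_neg br_xi_horizontal[OF phi_horizontal[OF h b] a]
        phi_psi_commute[OF h b])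
  have "br (br (\<xi> j) (\<xi> k)) x = br (\<xi> j) (br (\<xi> k) x) - br (\<xi> k) (br (\<xi> j) x)"
    using jacobi[of "\<xi> j" "\<xi> k" x] br_swap[of x "br (\<xi> j) (\<xi> k)"] br_swap[of x "\<xi> j"]
    by (simp add: br_neg algebra_simps)
  \<comment> \<open>On \<open>H\<close> the quaternionic relations
    \<open>\<phi> j \<phi> k = \<phi> i = - \<phi> k \<phi> j\<close> hold, so the commutator
    doubles instead of cancelling.\<close>
  also have "\<dots> = \<phi> i ?w + \<phi> i ?w"
    using phi_k[OF p2, of ?w] phi_k'[OF p2, of ?w] eta_horizontal[OF hh j] eta_horizontal[OF hh k]
    by (simp add: ad2[OF j k] ad2[OF k j])
  finally have br: "br (\<phi> i Z) x = (2 * \<delta>) *\<^sub>R br (\<xi> i) x - 2 *\<^sub>R \<phi> i ?w"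
    by (simp add: br_xi_xi[OF p] bilinear_lsub[OF bilinear_br] bilinear_lmul[OF bilinear_br]
        scaleR_2 algebra_simps)
  show ?thesis
    by (simp add: br br_xi_horizontal[OF x i] linear_add[OF linear_phi_i[OF i]]
        linear_scale[OF linear_phi_i[OF i]] algebra_simps)
qed

lemma br_Zvec_horizontal:
  assumes x: "x \<in> H"
  shows "br Z x = 2 *\<^sub>R (\<psi> (\<psi> x) + \<delta> *\<^sub>R \<psi> x)"
proof -
  obtain i j k where p: "(i, j, k) \<in> even_perms3"
    by (auto simp: even_perms3_def)
  then have i: "i \<in> {1, 2, 3}" using even_perms3_mem by blast
  note h = psi_horizontal[OF x]
  note hh = psi_horizontal[OF h]
  interpret A: abelian_almost_contact br "\<phi> i" "\<xi> i" "\<eta> i"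
    using abelian[OF i] .
  \<comment> \<open>Both arguments lie in the kernel of \<open>\<eta> i\<close>, so the abelian
    condition trades \<open>Z\<close> for \<open>\<phi> i Z\<close>.\<close>
  have "br Z x = br (\<phi> i Z) (\<phi> i x)"
    using A.br_phi_phi eta_horizontal[OF Zvec_horizontal i] eta_horizontal[OF x i] by simp
  also have "\<dots> = (-2) *\<^sub>R \<phi> i (\<psi> (\<psi> (\<phi> i x)) + \<delta> *\<^sub>R \<psi> (\<phi> i x))"
    by (rule br_phi_Zvec[OF p phi_horizontal[OF x i]])
  also have "\<dots> = (-2) *\<^sub>R (\<phi> i (\<phi> i (\<psi> (\<psi> x))) + \<delta> *\<^sub>R \<phi> i (\<phi> i (\<psi> x)))"
    by (simp add: phi_psi_commute[OF x i, symmetric] phi_psi_commute[OF h i, symmetric]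
        linear_add[OF A.linear_phi] linear_scale[OF A.linear_phi])
  also have "\<dots> = 2 *\<^sub>R (\<psi> (\<psi> x) + \<delta> *\<^sub>R \<psi> x)"
    by (simp only: phi_phi_horizontal[OF h i] phi_phi_horizontal[OF hh i])
      (simp add: scaleR_add_right scaleR_diff_right)
  finally show ?thesis .
qed

text \<open>Each \<open>\<eta> i\<close> is dual to the Reeb vectors. Hence these vectors and
  \<open>H\<close> span the algebra, and centrality need only be tested on them.\<close>

lemma horizontal_projection:
  "x - (\<Sum>j\<in>{1, 2, 3}. \<eta> j x *\<^sub>R \<xi> j) \<in> H"
proof -
  have "\<eta> i (x - (\<Sum>j\<in>{1, 2, 3}. \<eta> j x *\<^sub>R \<xi> j)) = 0" if i: "i \<in> {1, 2, 3}" for i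
  proof -
    have "(\<Sum>j\<in>{1, 2, 3}. \<eta> j x * \<eta> i (\<xi> j)) = (\<Sum>j\<in>{1, 2, 3}. if j = i then \<eta> i x else 0)"
      using i eta_xi_neq[OF i] almost_contact.eta_xi[OF almost_contact[OF i]]
      by (intro sum.cong) auto
    also have "\<dots> = \<eta> i x" using i by (simp only: sum.delta finite.intros if_True)
    finally show ?thesis
      by (simp only: linear_diff[OF linear_eta_i[OF i]] linear_sum[OF linear_eta_i[OF i]]
          linear_scale[OF linear_eta_i[OF i]] real_scaleR_def diff_self)
  qed
  then show ?thesis unfolding horizontal_def by blast
qed

lemma Zvec_central_iff:
  "Z \<in> lie_center br \<longleftrightarrow> (\<forall>x\<in>H. \<psi> (\<psi> x) + \<delta> *\<^sub>R \<psi> x = 0)"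
proof
  assume "Z \<in> lie_center br"
  then show "\<forall>x\<in>H. \<psi> (\<psi> x) + \<delta> *\<^sub>R \<psi> x = 0"
    using br_Zvec_horizontal by (simp add: lie_center_def)
next
  assume *: "\<forall>x\<in>H. \<psi> (\<psi> x) + \<delta> *\<^sub>R \<psi> x = 0"
  interpret ad: linear "br Z" using bilinear_br by (simp add: bilinear_def)
  have "br Z x = 0" for x
  proof -
    let ?s = "\<Sum>j\<in>{1, 2, 3}. \<eta> j x *\<^sub>R \<xi> j"
    \<comment> \<open>This vertical part vanishes unconditionally; the hypothesis \<open>*\<close>
      enters only for the horizontal part.\<close>
    have "br Z ?s = 0"
      by (simp only: ad.sum ad.scale) (intro sum.neutral, auto simp: br_Zvec_xi)
    moreover have "br Z (x - ?s) = 0"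
      using br_Zvec_horizontal[OF horizontal_projection] * horizontal_projection by simp
    ultimately show ?thesis by (simp only: ad.diff) simp
  qed
  then show "Z \<in> lie_center br" by (simp add: lie_center_def)
qed

end

theorem corollary4p12:
  fixes br :: "'a::real_vector \<Rightarrow> 'a \<Rightarrow> 'a"
    and \<phi> :: "nat \<Rightarrow> 'a \<Rightarrow> 'a" and \<xi> :: "nat \<Rightarrow> 'a" and \<eta> :: "nat \<Rightarrow> 'a \<Rightarrow> real"
  assumes "abelian_almost_3_contact_lie_algebra br \<phi> \<xi> \<eta>"
  shows "Zvec br \<phi> \<xi> \<in> lie_center br \<longleftrightarrow>
    (\<forall>x\<in>horizontal \<eta>.
      psi br \<phi> \<xi> (psi br \<phi> \<xi> x) + delta br \<xi> \<eta> *\<^sub>R psi br \<phi> \<xi> x = 0)"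
  by (rule abelian_almost_3_contact_lie_algebra.Zvec_central_iff[OF assms])

end
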